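(* Let $1\le d<d_Z$ and $p\ge 1$ be integers, let $\tau>0$, and let $G_\theta:\mathbb{R}^d\times\mathbb{R}^{d_Z-d}\to\mathbb{R}^p$ be a map. Let $u$ be a random vector in $\mathbb{R}^d$ with finite second moment, mean $m_u:=\mathbb{E}[u]$ and covariance $\Sigma_u:=\mathrm{Cov}(u)$. Assume $G_\theta$ is differentiable at $(m_u,0)$. Let $\eta\sim\mathcal{N}(0,I_d)$ and $z_{\mathrm{rec}}\sim\mathcal{N}(0,I_{d_Z-d})$ be such that $(u,\eta,z_{\mathrm{rec}})$ are independent, and set $z_{\mathrm{aux}}:=u+\tau\eta$ (so that $z_{\mathrm{aux}}\mid u\sim\mathcal{N}(u,\tau^2 I_d)$ and $z_{\mathrm{rec}}$ is independent of $(u,z_{\mathrm{aux}})$). Let $$J_{\mathrm{aux}}:=\left.\frac{\partial G_\theta}{\partial z_{\mathrm{aux}}}\right|_{(m_u,0)}\in\mathbb{R}^{p\times d},\qquad J_{\mathrm{rec}}:=\left.\frac{\partial G_\theta}{\partial z_{\mathrm{rec}}}\right|_{(m_u,0)}\in\mathbb{R}^{p\times(d_Z-d)},$$ and define the first-order approximation $$x_{\mathrm{lin}}:=G_\theta(m_u,0)+J_{\mathrm{aux}}(z_{\mathrm{aux}}-m_u)+J_{\mathrm{rec}}z_{\mathrm{rec}}.$$ Then $\mathbb{E}[x_{\mathrm{lin}}]=G_\theta(m_u,0)$ and $$\mathrm{Cov}(x_{\mathrm{lin}})=J_{\mathrm{aux}}(\Sigma_u+\tau^2I_d)J_{\mathrm{aux}}^\top+J_{\mathrm{rec}}J_{\mathrm{rec}}^\top.$$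 In particular, $$\mathrm{Cov}\bigl(J_{\mathrm{aux}}(z_{\mathrm{aux}}-m_u),\,J_{\mathrm{rec}}z_{\mathrm{rec}}\bigr)=0.$$
   Context: For square-integrable random vectors $a,b$, $\mathrm{Cov}(a,b):=\mathbb{E}[(a-\mathbb{E}a)(b-\mathbb{E}b)^\top]$ and $\mathrm{Cov}(a):=\mathrm{Cov}(a,a)$. The map $G_\theta$ is a (trained) generator taking latent variables $(z_{\mathrm{aux}},z_{\mathrm{rec}})$ to a field $x=G_\theta(z_{\mathrm{aux}},z_{\mathrm{rec}})\in\mathbb{R}^p$. The prior on latent variables ("soft-constrained prior") is $u\sim p(u)$, $z_{\mathrm{aux}}\mid u\sim\mathcal{N}(u,\tau^2I_d)$, $z_{\mathrm{rec}}\sim\mathcal{N}(0,I_{d_Z-d})$, with joint law $p(u)\,p(z_{\mathrm{aux}}\mid u)\,p(z_{\mathrm{rec}})$. *)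

theory Defs
  imports "HOL-Probability.Probability"
begin

definition square_integrable :: "'a measure \<Rightarrow> ('a \<Rightarrow> 'b::euclidean_space) \<Rightarrow> bool" where
  "square_integrable M X \<longleftrightarrow>
     X \<in> borel_measurable M \<and> integrable M (\<lambda>\<omega>. (norm (X \<omega>))\<^sup>2)"

definition outer_prod :: "real ^ 'm \<Rightarrow> real ^ 'n \<Rightarrow> real ^ 'n ^ 'm" where
  "outer_prod a b = (\<chi> i j. a $ i * b $ j)"

text \<open>
  The integrals are Bochner integrals, of vectors and of matrices. As usual they return the
  default value 0 when the integrand is not integrable, so cross-covariances are meaningful for
  square-integrable arguments only.
\<close>

definition cross_cov :: "'a measure \<Rightarrow> ('a \<Rightarrow> real ^ 'm) \<Rightarrow> ('a \<Rightarrow> real ^ 'n) \<Rightarrow> real ^ 'n ^ 'm" where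
  "cross_cov M a b =
     (\<integral>\<omega>. outer_prod (a \<omega> - integral\<^sup>L M a) (b \<omega> - integral\<^sup>L M b) \<partial>M)"

definition cov :: "'a measure \<Rightarrow> ('a \<Rightarrow> real ^ 'm) \<Rightarrow> real ^ 'm ^ 'm" where
  "cov M a = cross_cov M a a"

text \<open>The density of \<open>N(0, I)\<close> on \<open>real ^ 'n\<close> with respect to Lebesgue measure.\<close>

definition std_mvn_density :: "real ^ 'n \<Rightarrow> real" where
  "std_mvn_density x = exp (- (norm x)\<^sup>2 / 2) / sqrt (2 * pi) ^ CARD('n)"

definition std_mvn_distributed :: "'a measure \<Rightarrow> ('a \<Rightarrow> real ^ 'n) \<Rightarrow> bool" where
  "std_mvn_distributed M X \<longleftrightarrow> distributed M lborel X (\<lambda>x. ennreal (std_mvn_density x))"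

text \<open>
  Mutual independence of three random variables with values in different types. The library's
  \<open>indep_vars\<close> needs a common value type; as there, independence means that the generated
  sigma-algebras are independent.
\<close>

definition indep_triple ::
  "'a measure \<Rightarrow> ('a \<Rightarrow> 'b::topological_space) \<Rightarrow> ('a \<Rightarrow> 'c::topological_space)
     \<Rightarrow> ('a \<Rightarrow> 'd::topological_space) \<Rightarrow> bool" where
  "indep_triple M X Y Z \<longleftrightarrow>
     X \<in> borel_measurable M \<and> Y \<in> borel_measurable M \<and> Z \<in> borel_measurable M \<and>
     prob_space.indep_sets M
       (\<lambda>i. [sets (vimage_algebra (space M) X borel),
             sets (vimage_algebra (space M) Y borel),
             sets (vimage_algebra (space M) Z borel)] ! i) {..<3}"

end

theory Submission
  imports Defs
begin

text \<open>
  The recentred \<open>z_aux\<close> and \<open>z_rec\<close> are uncorrelated, so the covariance of the affine image splits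
  as \<open>A Cov(z_aux) A\<^sup>T + B Cov(z_rec) B\<^sup>T\<close>; likewise \<open>Cov(u + \<tau> \<eta>) = Cov(u) + \<tau>\<^sup>2 Cov(\<eta>)\<close>. The
  moments of \<open>N(0, I)\<close> come from factorising density and Lebesgue measure over the coordinates.
\<close>

section \<open>Square-integrable vectors: sums, linear images, translates\<close>

lemma integrable_norm_bound:
  fixes f :: "'a \<Rightarrow> 'b::{banach, second_countable_topology}" and g :: "'a \<Rightarrow> real"
  assumes "integrable M g" "f \<in> borel_measurable M" "\<And>\<omega>. norm (f \<omega>) \<le> g \<omega>"
  shows "integrable M f"
  using assms(1,2)
  by (rule Bochner_Integration.integrable_bound)
     (rule AE_I2, rule order_trans[OF assms(3)], simp)

lemma square_integrable_add:
  assumes "square_integrable M X" "square_integrable M Y"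
  shows "square_integrable M (\<lambda>\<omega>. X \<omega> + Y \<omega>)"
  unfolding square_integrable_def
proof
  have [measurable]: "X \<in> borel_measurable M" "Y \<in> borel_measurable M"
    using assms by (auto simp: square_integrable_def)
  show "(\<lambda>\<omega>. X \<omega> + Y \<omega>) \<in> borel_measurable M" by measurable
  have "(norm (X \<omega> + Y \<omega>))\<^sup>2 \<le> 2 * (norm (X \<omega>))\<^sup>2 + 2 * (norm (Y \<omega>))\<^sup>2" for \<omega>
  proof -
    have "(norm (X \<omega> + Y \<omega>))\<^sup>2 \<le> (norm (X \<omega>) + norm (Y \<omega>))\<^sup>2"
      by (intro power_mono norm_triangle_ineq) auto
    also have "\<dots> \<le> 2 * (norm (X \<omega>))\<^sup>2 + 2 * (norm (Y \<omega>))\<^sup>2"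
      using sum_squares_bound[of "norm (X \<omega>)" "norm (Y \<omega>)"] by (simp add: power2_sum)
    finally show ?thesis .
  qed
  then show "integrable M (\<lambda>\<omega>. (norm (X \<omega> + Y \<omega>))\<^sup>2)"
    using assms
    by - (rule integrable_norm_bound[of M "\<lambda>\<omega>. 2 * (norm (X \<omega>))\<^sup>2 + 2 * (norm (Y \<omega>))\<^sup>2"],
           simp_all add: square_integrable_def)
qed

text \<open>A bound \<open>K\<close> for the operator \<open>T\<close> dominates the new squared
  norm by \<open>K\<^sup>2\<close> times the old one. It is applied both to multiplication by a
  matrix and to scaling by \<tau>.\<close>

lemma square_integrable_bounded_linear:
  assumes "bounded_linear T" "square_integrable M X"
  shows "square_integrable M (\<lambda>\<omega>. T (X \<omega>))"
  unfolding square_integrable_def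
proof
  interpret T: bounded_linear T by fact
  have [measurable]: "X \<in> borel_measurable M" "T \<in> borel_measurable borel"
    using assms borel_measurable_continuous_onI[OF T.continuous_on[OF continuous_on_id]]
    by (auto simp: square_integrable_def)
  show "(\<lambda>\<omega>. T (X \<omega>)) \<in> borel_measurable M" by measurable
  obtain K where K: "\<And>x. norm (T x) \<le> norm x * K" using T.bounded by blast
  have "(norm (T (X \<omega>)))\<^sup>2 \<le> K\<^sup>2 * (norm (X \<omega>))\<^sup>2" for \<omega>
    using power_mono[OF K[of "X \<omega>"], of 2] by (simp add: power_mult_distrib mult.commute)
  then show "integrable M (\<lambda>\<omega>. (norm (T (X \<omega>)))\<^sup>2)"
    using assms
    by - (rule integrable_norm_bound[of M "\<lambda>\<omega>. K\<^sup>2 * (norm (X \<omega>))\<^sup>2"],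
           simp_all add: square_integrable_def)
qed

lemma (in finite_measure) square_integrable_const: "square_integrable M (\<lambda>_. c)"
  by (simp add: square_integrable_def)

text \<open>From 2t \<le> 1 + t^2 comes t \<le> 1 + t^2 for t \<ge> 0, and the constant 1 is
  integrable because the measure is finite.\<close>

lemma (in finite_measure) square_integrable_integrable:
  assumes "square_integrable M X"
  shows "integrable M X"
proof (rule integrable_norm_bound[of M "\<lambda>\<omega>. 1 + (norm (X \<omega>))\<^sup>2"])
  show "norm (X \<omega>) \<le> 1 + (norm (X \<omega>))\<^sup>2" for \<omega>
    using sum_squares_bound[of 1 "norm (X \<omega>)"] norm_ge_zero[of "X \<omega>"]
    unfolding power_one mult_1_right by linarith
qed (use assms in \<open>simp_all add: square_integrable_def\<close>)

lemma (in finite_measure) square_integrable_centered: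
  assumes "square_integrable M X"
  shows "square_integrable M (\<lambda>\<omega>. X \<omega> - c)"
  using square_integrable_add[OF assms square_integrable_const[of "- c"]] by simp

section \<open>Outer products and the calculus of cross-covariances\<close>

lemma bounded_bilinear_outer_prod: "bounded_bilinear outer_prod"
  \<comment> \<open>In finite dimension bilinearity already gives boundedness. The bounded form
    supplies the norm estimate, the continuity and the additivity used below.\<close>
  by (rule bilinear_conv_bounded_bilinear[THEN iffD1])
     (auto simp: bilinear_def linear_iff outer_prod_def vec_eq_iff algebra_simps)

text \<open>With outer products read as v w^T, this is (A v)(B w)^T = A (v w^T) B^T. It is what lets
  constant matrices leave a covariance.\<close>

lemma outer_prod_mult_vec:
  "outer_prod (A *v v) (B *v w) = A ** outer_prod v w ** transpose B"
  by (simp add: outer_prod_def vec_eq_iff matrix_vector_mult_def matrix_matrix_mult_def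
      transpose_def sum_product sum_distrib_right sum_distrib_left mult_ac)

text \<open>The bilinear bound reduces the claim to the product of the norms, which is at most the
  sum of their squares. Measurability comes from continuity of the bilinear map.\<close>

lemma integrable_outer_prod:
  fixes X :: "'a \<Rightarrow> real ^ 'm" and Y :: "'a \<Rightarrow> real ^ 'n"
  assumes "square_integrable M X" "square_integrable M Y"
  shows "integrable M (\<lambda>\<omega>. outer_prod (X \<omega>) (Y \<omega>))"
proof -
  have [measurable]: "X \<in> borel_measurable M" "Y \<in> borel_measurable M"
    using assms by (auto simp: square_integrable_def)
  obtain K where "0 \<le> K" and
      K: "\<And>(x :: real^'m) (y :: real^'n). norm (outer_prod x y) \<le> norm x * norm y * K"
    using bounded_bilinear.nonneg_bounded[OF bounded_bilinear_outer_prod] by blast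
  have bound: "norm (outer_prod (X \<omega>) (Y \<omega>)) \<le> K * ((norm (X \<omega>))\<^sup>2 + (norm (Y \<omega>))\<^sup>2)" for \<omega>
  proof -
    have "norm (X \<omega>) * norm (Y \<omega>) \<le> (norm (X \<omega>))\<^sup>2 + (norm (Y \<omega>))\<^sup>2"
      using sum_squares_bound[of "norm (X \<omega>)" "norm (Y \<omega>)"]
        mult_nonneg_nonneg[OF norm_ge_zero[of "X \<omega>"] norm_ge_zero[of "Y \<omega>"]] by linarith
    then show ?thesis
      using K[of "X \<omega>" "Y \<omega>"] \<open>0 \<le> K\<close>
      by (smt (verit) mult.commute mult_left_mono)
  qed
  have meas: "(\<lambda>\<omega>. outer_prod (X \<omega>) (Y \<omega>)) \<in> borel_measurable M"
    by (rule borel_measurable_continuous_Pair)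
       (auto intro!: bounded_bilinear.continuous_on[OF bounded_bilinear_outer_prod] continuous_intros)
  have int: "integrable M (\<lambda>\<omega>. K * ((norm (X \<omega>))\<^sup>2 + (norm (Y \<omega>))\<^sup>2))"
    using assms by (simp add: square_integrable_def)
  show ?thesis
    by (rule integrable_norm_bound[OF int meas bound])
qed

lemma (in finite_measure) integrable_outer_prod_centered:
  assumes "square_integrable M X" "square_integrable M Y"
  shows "integrable M (\<lambda>\<omega>. outer_prod (X \<omega> - a) (Y \<omega> - b))"
  by (intro integrable_outer_prod square_integrable_centered assms)

text \<open>The means add, so the centred sum is the sum of the centred summands. Square
  integrability makes both outer products integrable, which allows the integral to be split.\<close>

lemma (in finite_measure) cross_cov_add_left:
  assumes "square_integrable M X" "square_integrable M Y" "square_integrable M Z"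
  shows "cross_cov M (\<lambda>\<omega>. X \<omega> + Y \<omega>) Z = cross_cov M X Z + cross_cov M Y Z"
proof -
  have "cross_cov M (\<lambda>\<omega>. X \<omega> + Y \<omega>) Z =
      (\<integral>\<omega>. outer_prod (X \<omega> - integral\<^sup>L M X) (Z \<omega> - integral\<^sup>L M Z) +
           outer_prod (Y \<omega> - integral\<^sup>L M Y) (Z \<omega> - integral\<^sup>L M Z) \<partial>M)"
    unfolding cross_cov_def
    by (simp add: square_integrable_integrable assms add_diff_add
        flip: bounded_bilinear.add_left[OF bounded_bilinear_outer_prod])
  then show ?thesis
    by (simp add: cross_cov_def integrable_outer_prod_centered assms)
qed

lemma (in finite_measure) cross_cov_add_right:
  assumes "square_integrable M X" "square_integrable M Y" "square_integrable M Z"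
  shows "cross_cov M Z (\<lambda>\<omega>. X \<omega> + Y \<omega>) = cross_cov M Z X + cross_cov M Z Y"
proof -
  have "cross_cov M Z (\<lambda>\<omega>. X \<omega> + Y \<omega>) =
      (\<integral>\<omega>. outer_prod (Z \<omega> - integral\<^sup>L M Z) (X \<omega> - integral\<^sup>L M X) +
           outer_prod (Z \<omega> - integral\<^sup>L M Z) (Y \<omega> - integral\<^sup>L M Y) \<partial>M)"
    unfolding cross_cov_def
    by (simp add: square_integrable_integrable assms add_diff_add
        flip: bounded_bilinear.add_right[OF bounded_bilinear_outer_prod])
  then show ?thesis
    by (simp add: cross_cov_def integrable_outer_prod_centered assms)
qed

text \<open>Scaling commutes with the Bochner integral even at its default value 0: for a nonzero
  factor the scaled and the unscaled integrand are integrable together, and for factor 0 both sides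
  vanish.\<close>

lemma cross_cov_scaleR_left:
  "cross_cov M (\<lambda>\<omega>. c *\<^sub>R X \<omega>) Z = c *\<^sub>R cross_cov M X Z"
  unfolding cross_cov_def
  by (simp only: integral_scaleR_right scaleR_diff_right[symmetric]
      bounded_bilinear.scaleR_left[OF bounded_bilinear_outer_prod])

lemma cross_cov_scaleR_right:
  "cross_cov M Z (\<lambda>\<omega>. c *\<^sub>R X \<omega>) = c *\<^sub>R cross_cov M Z X"
  unfolding cross_cov_def
  by (simp only: integral_scaleR_right scaleR_diff_right[symmetric]
      bounded_bilinear.scaleR_right[OF bounded_bilinear_outer_prod])

text \<open>Total mass 1 gives the constants \<open>a\<close> and \<open>b\<close> the means
  \<open>a\<close> and \<open>b\<close>, so they cancel in the centring.\<close>

lemma (in prob_space) cross_cov_translate: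
  assumes "integrable M X" "integrable M Y"
  shows "cross_cov M (\<lambda>\<omega>. a + X \<omega>) (\<lambda>\<omega>. b + Y \<omega>) = cross_cov M X Y"
  using assms by (simp add: cross_cov_def prob_space)

text \<open>The map taking C to A C B^T is linear on a finite-dimensional space, hence bounded, and
  so commutes with the Bochner integral of the outer product.\<close>

lemma (in finite_measure) cross_cov_mult_vec:
  assumes "square_integrable M X" "square_integrable M Y"
  shows "cross_cov M (\<lambda>\<omega>. A *v X \<omega>) (\<lambda>\<omega>. B *v Y \<omega>) = A ** cross_cov M X Y ** transpose B"
proof -
  have mean: "(\<integral>\<omega>. C *v Z \<omega> \<partial>M) = C *v integral\<^sup>L M Z" if "square_integrable M Z"
    for C :: "real^'k^'l" and Z
    by (intro integral_bounded_linear square_integrable_integrable that) simp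
  have "bounded_linear (\<lambda>C. A ** C ** transpose B)"
    unfolding linear_conv_bounded_linear[symmetric]
    by (intro linearI)
       (simp_all add: matrix_matrix_mult_def vec_eq_iff sum.distrib sum_distrib_left
          algebra_simps)
  from integral_bounded_linear[OF this integrable_outer_prod_centered[OF assms]]
  show ?thesis
    unfolding cross_cov_def mean[OF assms(1)] mean[OF assms(2)]
    by (simp flip: matrix_vector_mult_diff_distrib outer_prod_mult_vec)
qed
text \<open>Reading off an entry is a bounded linear functional. This reduces matrix identities to
  expectations of real products, where independence and the normal moments apply.\<close>

lemma (in finite_measure) cross_cov_nth:
  assumes "square_integrable M X" "square_integrable M Y"
  shows "cross_cov M X Y $ i $ j =
    (\<integral>\<omega>. (X \<omega> $ i - integral\<^sup>L M X $ i) * (Y \<omega> $ j - integral\<^sup>L M Y $ j) \<partial>M)"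
proof -
  have "bounded_linear (\<lambda>C. C $ i $ j :: real)"
    by (rule bounded_linear_compose[OF bounded_linear_vec_nth bounded_linear_vec_nth])
  from integral_bounded_linear[OF this integrable_outer_prod_centered[OF assms], symmetric]
  show ?thesis
    by (simp add: cross_cov_def outer_prod_def)
qed

lemma (in finite_measure) transpose_cross_cov:
  assumes "square_integrable M X" "square_integrable M Y"
  shows "transpose (cross_cov M X Y) = cross_cov M Y X"
  by (simp add: vec_eq_iff transpose_def cross_cov_nth assms mult.commute)

lemma integral_vec_nth:
  assumes "integrable M X"
  shows "integral\<^sup>L M X $ i = (\<integral>\<omega>. X \<omega> $ i \<partial>M)"
  using integral_bounded_linear[OF bounded_linear_vec_nth assms] by simp

section \<open>Independence and vanishing cross-covariance\<close>

lemma (in prob_space) indep_var_compose_vimage_algebra: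
  assumes indep: "indep_set (sets (vimage_algebra (space M) X S)) (sets (vimage_algebra (space M) Y T))"
    and X: "X \<in> measurable M S" and Y: "Y \<in> measurable M T"
    and f: "f \<in> measurable S S'" and g: "g \<in> measurable T T'"
  shows "indep_var S' (\<lambda>\<omega>. f (X \<omega>)) T' (\<lambda>\<omega>. g (Y \<omega>))"
proof -
  \<comment> \<open>A function of \<open>X\<close> generates a smaller sigma-algebra than
    \<open>X\<close> does, and independence passes to subfamilies of events.\<close>
  have "sets (vimage_algebra (space M) (\<lambda>\<omega>. f (X \<omega>)) S') \<subseteq> sets (vimage_algebra (space M) X S)"
    using measurable_space[OF X] f
    by (intro sets_image_in_sets measurable_compose[OF measurable_vimage_algebra1]) auto
  moreover have "sets (vimage_algebra (space M) (\<lambda>\<omega>. g (Y \<omega>)) T') \<subseteq> sets (vimage_algebra (space M) Y T)"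
    using measurable_space[OF Y] g
    by (intro sets_image_in_sets measurable_compose[OF measurable_vimage_algebra1]) auto
  ultimately have "indep_set (sets (vimage_algebra (space M) (\<lambda>\<omega>. f (X \<omega>)) S'))
      (sets (vimage_algebra (space M) (\<lambda>\<omega>. g (Y \<omega>)) T'))"
    using indep indep_setD_ev1[OF indep] indep_setD_ev2[OF indep]
    by (intro indep_setI) (auto intro!: indep_setD[OF indep])
  then show ?thesis
    using measurable_compose[OF X f] measurable_compose[OF Y g]
    by (simp add: indep_var_eq sets_vimage_algebra)
qed

text \<open>Entry by entry, the expectation of a product of independent centred coordinates is the
  product of their means, and the first of these is 0.\<close>

lemma (in prob_space) cross_cov_indep:
  fixes X :: "'a \<Rightarrow> real ^ 'm" and Y :: "'a \<Rightarrow> real ^ 'n"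
  assumes "indep_set (sets (vimage_algebra (space M) X borel)) (sets (vimage_algebra (space M) Y borel))"
    and "square_integrable M X" "square_integrable M Y"
  shows "cross_cov M X Y = 0"
proof -
  have X: "integrable M X" and Y: "integrable M Y"
    using assms by (auto intro: square_integrable_integrable)
  have X_nth: "integrable M (\<lambda>\<omega>. X \<omega> $ i)" for i
    using integrable_bounded_linear[OF bounded_linear_vec_nth X] .
  have Y_nth: "integrable M (\<lambda>\<omega>. Y \<omega> $ j)" for j
    using integrable_bounded_linear[OF bounded_linear_vec_nth Y] .
  have "cross_cov M X Y $ i $ j = 0" for i j
  proof -
    have nth: "(\<lambda>v :: real ^ 'k. v $ l - c) \<in> borel_measurable borel" for l c
      by (intro borel_measurable_continuous_onI continuous_intros)
    have "indep_var borel (\<lambda>\<omega>. X \<omega> $ i - integral\<^sup>L M X $ i)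
        borel (\<lambda>\<omega>. Y \<omega> $ j - integral\<^sup>L M Y $ j)"
      using assms by (intro indep_var_compose_vimage_algebra nth) (auto simp: square_integrable_def)
    then have "cross_cov M X Y $ i $ j =
        (\<integral>\<omega>. X \<omega> $ i - integral\<^sup>L M X $ i \<partial>M) * (\<integral>\<omega>. Y \<omega> $ j - integral\<^sup>L M Y $ j \<partial>M)"
      unfolding cross_cov_nth[OF assms(2,3)]
      by (rule indep_var_lebesgue_integral) (simp_all add: X_nth Y_nth)
    also have "(\<integral>\<omega>. X \<omega> $ i - integral\<^sup>L M X $ i \<partial>M) = 0"
      by (simp add: X_nth integral_vec_nth[OF X] prob_space)
    finally show ?thesis by simp
  qed
  then show ?thesis by (simp add: vec_eq_iff)
qed

lemma (in prob_space) indep_sets_imp_indep_set: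
  assumes "indep_sets F I" "i \<in> I" "j \<in> I" "i \<noteq> j"
  shows "indep_set (F i) (F j)"
proof (rule indep_setI)
  show "F i \<subseteq> events" "F j \<subseteq> events"
    using assms by (auto simp: indep_sets_def)
  show "prob (a \<inter> b) = prob a * prob b" if "a \<in> F i" "b \<in> F j" for a b
    \<comment> \<open>The chosen family of events has \<open>a\<close> at index \<open>i\<close> and
      \<open>b\<close> at index \<open>j\<close>; \<open>i \<noteq> j\<close> keeps the update from
      overwriting \<open>a\<close>.\<close>
    using indep_setsD[OF assms(1), of "{i, j}" "(\<lambda>_. a)(j := b)"] assms that by simp
qed

text \<open>A covariance involves two variables at a time, so mutual independence enters through its
  pairwise consequences.\<close>

lemma (in prob_space) indep_triple_imp_indep_set:
  assumes "indep_triple M X Y Z"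
  shows "indep_set (sets (vimage_algebra (space M) X borel)) (sets (vimage_algebra (space M) Y borel))"
    and "indep_set (sets (vimage_algebra (space M) X borel)) (sets (vimage_algebra (space M) Z borel))"
    and "indep_set (sets (vimage_algebra (space M) Y borel)) (sets (vimage_algebra (space M) Z borel))"
  using indep_sets_imp_indep_set[of _ "{..<3}" 0 1] indep_sets_imp_indep_set[of _ "{..<3}" 0 2]
    indep_sets_imp_indep_set[of _ "{..<3}" 1 2] assms
  unfolding indep_triple_def by (force simp: numeral_2_eq_2)+

section \<open>First and second moments of N(0, I)\<close>

lemma
  fixes f :: "'a::euclidean_space \<Rightarrow> real \<Rightarrow> real"
  assumes "\<And>b. b \<in> Basis \<Longrightarrow> integrable lborel (f b)"
  shows integrable_lborel_prod_Basis: "integrable lborel (\<lambda>x. \<Prod>b\<in>Basis. f b (x \<bullet> b))"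
    and integral_lborel_prod_Basis:
      "(\<integral>x. (\<Prod>b\<in>Basis. f b (x \<bullet> b)) \<partial>lborel) = (\<Prod>b\<in>Basis. \<integral>t. f b t \<partial>lborel)"
proof -
  interpret product_sigma_finite "\<lambda>_::'a. lborel :: real measure" ..
  have [measurable]: "f b \<in> borel_measurable borel" if "b \<in> Basis" for b
    using borel_measurable_integrable[OF assms[OF that]] by simp
  have meas: "(\<lambda>x. \<Prod>b\<in>Basis. f b (x \<bullet> b)) \<in> borel_measurable borel"
    by (intro borel_measurable_prod) measurable
  \<comment> \<open>By \<open>lborel_eq\<close>, Lebesgue measure is the image under this map of the
    product of one-dimensional Lebesgue measures over \<open>Basis\<close>. Fubini for finite
    products then yields both claims.\<close>
  have sum: "(\<lambda>y :: 'a \<Rightarrow> real. \<Sum>b\<in>Basis. y b *\<^sub>R b) \<in> Pi\<^sub>M Basis (\<lambda>_. lborel) \<rightarrow>\<^sub>M borel"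
    by measurable
  show "integrable lborel (\<lambda>x. \<Prod>b\<in>Basis. f b (x \<bullet> b))"
    by (subst lborel_eq) (simp add: integrable_distr_eq[OF sum meas] product_integrable_prod assms)
  show "(\<integral>x. (\<Prod>b\<in>Basis. f b (x \<bullet> b)) \<partial>lborel) = (\<Prod>b\<in>Basis. \<integral>t. f b t \<partial>lborel)"
    by (subst lborel_eq) (simp add: integral_distr[OF sum meas] product_integral_prod assms)
qed

text \<open>The squared norm is the sum of the squared coordinates, which \<open>exp\<close> turns
  into a product; the normalising power matches because \<open>Basis\<close> has
  \<open>CARD('n)\<close> elements.\<close>

lemma std_mvn_density_eq_prod:
  "std_mvn_density x = (\<Prod>b\<in>Basis. std_normal_density (x \<bullet> b))"
proof -
  have "(norm x)\<^sup>2 = (\<Sum>b\<in>Basis. (x \<bullet> b)\<^sup>2)"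
    unfolding power2_norm_eq_inner by (subst euclidean_inner) (simp add: power2_eq_square)
  then show ?thesis
    by (simp add: std_mvn_density_def std_normal_density_def prod_dividef prod.distrib
        exp_sum sum_negf sum_divide_distrib flip: exp_sum)
qed

text \<open>Allowing a separate function \<open>g b\<close> in each coordinate covers every mixed
  moment at once: the coordinates that do not occur receive the constant 1.\<close>

lemma
  fixes X :: "'a \<Rightarrow> real ^ 'n" and g :: "real ^ 'n \<Rightarrow> real \<Rightarrow> real"
  assumes X: "std_mvn_distributed M X"
    and meas: "\<And>b. b \<in> Basis \<Longrightarrow> g b \<in> borel_measurable borel"
    and int: "\<And>b. b \<in> Basis \<Longrightarrow> integrable lborel (\<lambda>t. std_normal_density t * g b t)"
  shows integrable_std_mvn_prod_Basis: "integrable M (\<lambda>\<omega>. \<Prod>b\<in>Basis. g b (X \<omega> \<bullet> b))"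
    and integral_std_mvn_prod_Basis: "(\<integral>\<omega>. (\<Prod>b\<in>Basis. g b (X \<omega> \<bullet> b)) \<partial>M) =
      (\<Prod>b\<in>Basis. \<integral>t. std_normal_density t * g b t \<partial>lborel)"
proof -
  have dist: "distributed M lborel X (\<lambda>x. ennreal (std_mvn_density x))"
    using X by (simp add: std_mvn_distributed_def)
  have nonneg: "0 \<le> std_mvn_density x" for x :: "real ^ 'n"
    by (simp add: std_mvn_density_def)
  note [measurable] = meas
  have prod: "(\<lambda>x. \<Prod>b\<in>Basis. g b (x \<bullet> b)) \<in> borel_measurable lborel"
    by (intro borel_measurable_prod) simp
  have eq: "std_mvn_density x * (\<Prod>b\<in>Basis. g b (x \<bullet> b)) =
      (\<Prod>b\<in>Basis. std_normal_density (x \<bullet> b) * g b (x \<bullet> b))" for x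
    by (simp only: std_mvn_density_eq_prod prod.distrib)
  show "integrable M (\<lambda>\<omega>. \<Prod>b\<in>Basis. g b (X \<omega> \<bullet> b))"
    unfolding distributed_integrable[OF dist prod nonneg, symmetric] eq
    by (rule integrable_lborel_prod_Basis[OF int])
  show "(\<integral>\<omega>. (\<Prod>b\<in>Basis. g b (X \<omega> \<bullet> b)) \<partial>M) =
      (\<Prod>b\<in>Basis. \<integral>t. std_normal_density t * g b t \<partial>lborel)"
    unfolding distributed_integral[OF dist prod nonneg, symmetric] eq
    by (rule integral_lborel_prod_Basis[OF int])
qed

lemma std_normal_moments:
  shows "has_bochner_integral lborel std_normal_density 1"
    and "has_bochner_integral lborel (\<lambda>t. std_normal_density t * t) 0"
    and "has_bochner_integral lborel (\<lambda>t. std_normal_density t * (t * t)) 1"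
  \<comment> \<open>These are the moments of orders 0, 1 and 2; the last is 2! / (2 * 1!) =
    1.\<close>
  using std_normal_moment_even[of 0] std_normal_moment_odd[of 0] std_normal_moment_even[of 1]
  by (simp_all add: power2_eq_square)

lemma
  fixes X :: "'a \<Rightarrow> real ^ 'n"
  assumes X: "std_mvn_distributed M X"
  shows integral_std_mvn_nth: "(\<integral>\<omega>. X \<omega> $ i \<partial>M) = 0"
    and integrable_std_mvn_nth_mult: "integrable M (\<lambda>\<omega>. X \<omega> $ i * X \<omega> $ j)"
    and integral_std_mvn_nth_mult: "(\<integral>\<omega>. X \<omega> $ i * X \<omega> $ j \<partial>M) = (if i = j then 1 else 0)"
proof -
  let ?e = "\<lambda>k. axis k 1 :: real ^ 'n"
  have e: "?e k \<in> Basis" for k by (simp add: axis_in_Basis_iff)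
  have nth: "X \<omega> $ k = (\<Prod>b\<in>Basis. if b = ?e k then X \<omega> \<bullet> b else 1)" for k \<omega>
    by (simp add: e inner_axis)
  \<comment> \<open>Each of \<open>i\<close> and \<open>j\<close> contributes a factor
    \<open>t\<close> to its own coordinate, so \<open>g b t\<close> is \<open>t * t\<close> where
    both meet, \<open>t\<close> where only one does, and 1 elsewhere.\<close>
  define g where "g b t = (if b = ?e i then t else 1) * (if b = ?e j then t else 1)" for b :: "real ^ 'n" and t :: real
  have g: "X \<omega> $ i * X \<omega> $ j = (\<Prod>b\<in>Basis. g b (X \<omega> \<bullet> b))" for \<omega>
    unfolding g_def prod.distrib nth ..
  \<comment> \<open>The integral is 0 exactly when one of the two indices, but not both, hits
    \<open>b\<close>. For \<open>i \<noteq> j\<close> such a \<open>b\<close> exists and kills the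
    product; for \<open>i = j\<close> all factors are 1.\<close>
  have int: "has_bochner_integral lborel (\<lambda>t. std_normal_density t * g b t)
      (if b = ?e i \<and> b \<noteq> ?e j \<or> b \<noteq> ?e i \<and> b = ?e j then 0 else 1)" for b
    using std_normal_moments by (cases "b = ?e i"; cases "b = ?e j") (simp_all add: g_def)
  have g_meas: "g b \<in> borel_measurable borel" for b
    unfolding g_def by measurable
  show "integrable M (\<lambda>\<omega>. X \<omega> $ i * X \<omega> $ j)"
    unfolding g
    by (rule integrable_std_mvn_prod_Basis[OF X g_meas]) (rule integrable.intros[OF int])
  show "(\<integral>\<omega>. X \<omega> $ i * X \<omega> $ j \<partial>M) = (if i = j then 1 else 0)"
    unfolding g
    by (subst integral_std_mvn_prod_Basis[OF X g_meas integrable.intros[OF int]])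
       (auto simp: has_bochner_integral_integral_eq[OF int] axis_eq_axis e intro!: prod.neutral)
  have int': "has_bochner_integral lborel (\<lambda>t. std_normal_density t * (if b = ?e i then t else 1))
      (if b = ?e i then 0 else 1)" for b
    using std_normal_moments by simp
  show "(\<integral>\<omega>. X \<omega> $ i \<partial>M) = 0"
    unfolding nth
    by (subst integral_std_mvn_prod_Basis[OF X _ integrable.intros[OF int']])
       (auto simp: has_bochner_integral_integral_eq[OF int'] e)
qed

lemma square_integrable_std_mvn:
  fixes X :: "'a \<Rightarrow> real ^ 'n"
  assumes "std_mvn_distributed M X"
  shows "square_integrable M X"
proof -
  have "X \<in> borel_measurable M"
    using assms distributed_measurable[of M lborel X] by (simp add: std_mvn_distributed_def)
  then show ?thesis
    by (simp add: square_integrable_def power2_norm_eq_inner inner_vec_def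
        integrable_std_mvn_nth_mult[OF assms])
qed

lemma (in prob_space) integral_std_mvn:
  assumes "std_mvn_distributed M X"
  shows "integral\<^sup>L M X = 0"
  using integral_vec_nth[OF square_integrable_integrable[OF square_integrable_std_mvn[OF assms]]]
  by (simp add: vec_eq_iff integral_std_mvn_nth[OF assms])

lemma (in prob_space) cov_std_mvn:
  assumes "std_mvn_distributed M X"
  shows "cov M X = mat 1"
  unfolding cov_def vec_eq_iff
  by (simp add: cross_cov_nth square_integrable_std_mvn integral_std_mvn integral_std_mvn_nth_mult
      assms mat_def)

section \<open>Mean and covariance of the first-order approximation\<close>

theorem lemma4p2:
  fixes M :: "'a measure"
    and G :: "(real ^ 'd) \<times> (real ^ 'r) \<Rightarrow> real ^ 'p"
    and \<tau> :: real
    and u \<eta> z_aux :: "'a \<Rightarrow> real ^ 'd"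
    and z_rec :: "'a \<Rightarrow> real ^ 'r"
    and m_u :: "real ^ 'd"
    and \<Sigma>_u :: "real ^ 'd ^ 'd"
    and J_aux :: "real ^ 'd ^ 'p"
    and J_rec :: "real ^ 'r ^ 'p"
    and x_lin :: "'a \<Rightarrow> real ^ 'p"
  assumes "prob_space M"
    and "\<tau> > 0"
    and "square_integrable M u"
  defines "m_u \<equiv> integral\<^sup>L M u"
    and "\<Sigma>_u \<equiv> cov M u"
  assumes "G differentiable (at (m_u, 0))"
    and "std_mvn_distributed M \<eta>"
    and "std_mvn_distributed M z_rec"
    and "indep_triple M u \<eta> z_rec"
  defines "z_aux \<equiv> (\<lambda>\<omega>. u \<omega> + \<tau> *\<^sub>R \<eta> \<omega>)"
    and "J_aux \<equiv> jacobian (\<lambda>z. G (z, 0)) (at m_u)"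
    and "J_rec \<equiv> jacobian (\<lambda>z. G (m_u, z)) (at 0)"
    and "x_lin \<equiv> (\<lambda>\<omega>. G (m_u, 0) + J_aux *v (z_aux \<omega> - m_u) + J_rec *v z_rec \<omega>)"
  shows "square_integrable M x_lin \<and>
         square_integrable M (\<lambda>\<omega>. J_aux *v (z_aux \<omega> - m_u)) \<and>
         square_integrable M (\<lambda>\<omega>. J_rec *v z_rec \<omega>) \<and>
         integral\<^sup>L M x_lin = G (m_u, 0) \<and>
         cov M x_lin =
           J_aux ** (\<Sigma>_u + \<tau>\<^sup>2 *\<^sub>R mat 1) ** transpose J_aux + J_rec ** transpose J_rec \<and>
         cross_cov M (\<lambda>\<omega>. J_aux *v (z_aux \<omega> - m_u)) (\<lambda>\<omega>. J_rec *v z_rec \<omega>) = 0"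
proof -
  interpret prob_space M by fact
  have u: "square_integrable M u"
    and \<eta>: "square_integrable M \<eta>" and z_rec: "square_integrable M z_rec"
    using assms by (auto intro: square_integrable_std_mvn)
  have scaled: "square_integrable M (\<lambda>\<omega>. \<tau> *\<^sub>R \<eta> \<omega>)"
    by (rule square_integrable_bounded_linear[OF bounded_linear_scaleR_right \<eta>])
  have z_aux: "square_integrable M z_aux"
    unfolding z_aux_def by (rule square_integrable_add[OF u scaled])
  note indep = indep_triple_imp_indep_set[OF \<open>indep_triple M u \<eta> z_rec\<close>]
  \<comment> \<open>Independence is available in the order \<open>u\<close>, \<eta>; transposing
    gives the other mixed term.\<close>
  have cross_\<eta>_u: "cross_cov M \<eta> u = 0"
    using transpose_cross_cov[OF u \<eta>] cross_cov_indep[OF indep(1) u \<eta>]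
    by (simp add: transpose_def vec_eq_iff)
  have mean_z_aux: "integral\<^sup>L M z_aux = m_u"
    unfolding z_aux_def m_u_def
    by (simp add: square_integrable_integrable u \<eta> integral_std_mvn assms(7))
  have cov_z_aux: "cross_cov M z_aux z_aux = \<Sigma>_u + \<tau>\<^sup>2 *\<^sub>R mat 1"
    unfolding z_aux_def \<Sigma>_u_def
    \<comment> \<open>Expansion into four terms, of which the mixed ones vanish. Since \<tau> may be
      pulled out of the left slot before the right one is expanded, the right expansion is supplied
      for \<open>\<tau> *\<^sub>R \<eta>\<close> and for \<eta> on the left.\<close>
    by (simp add: cross_cov_add_left[OF u scaled square_integrable_add[OF u scaled]]
        cross_cov_add_right[OF u scaled u] cross_cov_add_right[OF u scaled scaled]
        cross_cov_add_right[OF u scaled \<eta>] cross_cov_scaleR_left cross_cov_scaleR_right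
        cross_cov_indep[OF indep(1) u \<eta>] cross_\<eta>_u cov_std_mvn[OF assms(7), unfolded cov_def]
        cov_def power2_eq_square)
  have cross: "cross_cov M z_aux z_rec = 0"
    unfolding z_aux_def
    by (simp add: cross_cov_add_left u scaled z_rec cross_cov_scaleR_left
        cross_cov_indep[OF indep(2) u z_rec] cross_cov_indep[OF indep(3) \<eta> z_rec])
  let ?a = "\<lambda>\<omega>. J_aux *v (z_aux \<omega> - m_u)" and ?r = "\<lambda>\<omega>. J_rec *v z_rec \<omega>"
  have centered: "square_integrable M (\<lambda>\<omega>. z_aux \<omega> - m_u)"
    by (rule square_integrable_centered[OF z_aux])
  have a: "square_integrable M ?a" and r: "square_integrable M ?r"
    using square_integrable_bounded_linear[OF matrix_vector_mul_bounded_linear] centered z_rec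
    by blast+
  have ar: "square_integrable M (\<lambda>\<omega>. ?a \<omega> + ?r \<omega>)"
    by (rule square_integrable_add[OF a r])
  \<comment> \<open>Isolating the constant in front gives the shape that
    \<open>cross_cov_translate\<close> removes.\<close>
  have x_lin: "x_lin = (\<lambda>\<omega>. G (m_u, 0) + (?a \<omega> + ?r \<omega>))"
    by (simp add: x_lin_def add.assoc)
  have mean_a: "integral\<^sup>L M ?a = 0"
    using integral_bounded_linear[OF matrix_vector_mul_bounded_linear
        square_integrable_integrable[OF centered], of J_aux]
    by (simp add: square_integrable_integrable z_aux mean_z_aux prob_space)
  have mean_r: "integral\<^sup>L M ?r = 0"
    using integral_bounded_linear[OF matrix_vector_mul_bounded_linear
        square_integrable_integrable[OF z_rec], of J_rec]
    by (simp add: integral_std_mvn assms(8))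
  have cross_centered: "cross_cov M (\<lambda>\<omega>. z_aux \<omega> - m_u) z_rec = 0"
    \<comment> \<open>Subtracting the mean is a translation by \<open>- m_u\<close>; the second
      variable is shifted by 0.\<close>
    using cross_cov_translate[of z_aux z_rec "- m_u" 0] cross z_aux z_rec
    by (simp add: square_integrable_integrable)
  have cov_centered: "cross_cov M (\<lambda>\<omega>. z_aux \<omega> - m_u) (\<lambda>\<omega>. z_aux \<omega> - m_u) = \<Sigma>_u + \<tau>\<^sup>2 *\<^sub>R mat 1"
    using cross_cov_translate[of z_aux z_aux "- m_u" "- m_u"] cov_z_aux z_aux
    by (simp add: square_integrable_integrable)
  have cross_ar: "cross_cov M ?a ?r = 0"
    unfolding cross_cov_mult_vec[OF centered z_rec] cross_centered
    by (simp add: matrix_matrix_mult_def vec_eq_iff)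
  then have cross_ra: "cross_cov M ?r ?a = 0"
    using transpose_cross_cov[OF a r] by (simp add: transpose_def vec_eq_iff)
  have "square_integrable M x_lin"
    unfolding x_lin by (rule square_integrable_add[OF square_integrable_const ar])
  moreover have "integral\<^sup>L M x_lin = G (m_u, 0)"
    unfolding x_lin
    by (simp add: square_integrable_integrable a r mean_a mean_r prob_space)
  moreover have "cov M x_lin =
      J_aux ** (\<Sigma>_u + \<tau>\<^sup>2 *\<^sub>R mat 1) ** transpose J_aux + J_rec ** transpose J_rec"
  proof -
    have "cov M x_lin = cross_cov M (\<lambda>\<omega>. ?a \<omega> + ?r \<omega>) (\<lambda>\<omega>. ?a \<omega> + ?r \<omega>)"
      unfolding x_lin cov_def
      by (intro cross_cov_translate square_integrable_integrable ar)
    \<comment> \<open>Both mixed blocks vanish, by \<open>cross_ar\<close> and its transpose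
      \<open>cross_ra\<close>.\<close>
    also have "\<dots> = cross_cov M ?a ?a + cross_cov M ?r ?r"
      by (simp only: cross_cov_add_left[OF a r ar] cross_cov_add_right[OF a r a]
          cross_cov_add_right[OF a r r] cross_ar cross_ra) simp
    also have "\<dots> = J_aux ** (\<Sigma>_u + \<tau>\<^sup>2 *\<^sub>R mat 1) ** transpose J_aux + J_rec ** transpose J_rec"
      unfolding cross_cov_mult_vec[OF centered centered] cross_cov_mult_vec[OF z_rec z_rec]
        cov_centered cov_std_mvn[OF assms(8), unfolded cov_def]
      by simp
    finally show ?thesis .
  qed
  ultimately show ?thesis
    using a r cross_ar by blast
qed

end
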